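(* For every integer $i\ge 1$ there exists an integer $M$ (depending only on $i$) such that the following holds for every odd integer $m\ge M$ with $\gcd(i,m)=1$. Put $q=2^i$, let $a\in\mathbb{F}_{2^m}$, and let $G_{a,1,1,a}:\mathbb{F}_{2^m}^3\to\mathbb{F}_{2^m}^3$ be the function $$G_{a,1,1,a}(x,y,z)=\big(x^{q+1}+ax^qz+yz^q,\ \ x^qz+y^{q+1},\ \ xy^q+ay^qz+z^{q+1}\big).$$ Then $G_{a,1,1,a}$ is a permutation of $\mathbb{F}_{2^m}^3$ if and only if the polynomial $$P_a(T)=T^{q^2+q+1}+a\,T^{q^2+q}+1$$ has no roots in $\mathbb{F}_{2^{2m}}$.
   Context: A function $\mathbb{F}_{2^m}^3\to\mathbb{F}_{2^m}^3$ is called a permutation if it is bijective. *)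

theory Defs
  imports "HOL-Algebra.Algebraic_Closure_Type" "HOL-Library.Z2"
begin

text \<open>
  All finite fields of characteristic 2 are taken inside one fixed algebraic closure of the
  prime field, the type \<^typ>\<open>bit alg_closure\<close>; this makes the inclusion of the field with
  \<open>2^m\<close> elements in the field with \<open>2^(2*m)\<close> elements literal.  The field with \<open>2^n\<close> elements
  is the set of roots of \<open>X^(2^n) - X\<close>; the lemma \<open>subfield_card_iff_GF2\<close> below shows that
  for \<open>n > 0\<close> this is the one and only subfield of the closure that has \<open>2^n\<close> elements.
\<close>

definition GF2 :: "nat \<Rightarrow> bit alg_closure set" where
  "GF2 n = {x. x ^ (2 ^ n) = x}"

definition G_a11a ::
    "nat \<Rightarrow> 'a::comm_ring_1 \<Rightarrow> 'a \<times> 'a \<times> 'a \<Rightarrow> 'a \<times> 'a \<times> 'a" where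
  "G_a11a q a = (\<lambda>(x, y, z).
     (x ^ (q + 1) + a * x ^ q * z + y * z ^ q,
      x ^ q * z + y ^ (q + 1),
      x * y ^ q + a * y ^ q * z + z ^ (q + 1)))"

definition P_poly :: "nat \<Rightarrow> 'a::comm_ring_1 \<Rightarrow> 'a poly" where
  "P_poly q a = Polynomial.monom 1 (q^2 + q + 1) + Polynomial.monom a (q^2 + q) + 1"


subsection \<open>\<open>GF2 n\<close> is the subfield with \<open>2^n\<close> elements\<close>

lemma two_eq_0_closure: "(2 :: bit alg_closure) = 0"
proof -
  have "to_ac (2 :: bit) = (2 :: bit alg_closure)" by (rule to_ac_numeral)
  moreover have "(2 :: bit) = 0" by simp
  ultimately show ?thesis by simp
qed

lemma uminus_closure: "- x = (x :: bit alg_closure)"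
proof -
  have "x + x = 2 * x" by simp
  also have "\<dots> = 0" by (simp add: two_eq_0_closure)
  finally show ?thesis by (simp add: add_eq_0_iff)
qed

lemma power_two_power_add:
  "(x + y :: bit alg_closure) ^ (2 ^ n) = x ^ (2 ^ n) + y ^ (2 ^ n)"
proof (induction n)
  case (Suc n)
  have "(x + y) ^ (2 ^ Suc n) = ((x + y) ^ (2 ^ n)) ^ 2"
    by (simp add: power_mult [symmetric] mult.commute)
  also have "\<dots> = (x ^ (2 ^ n) + y ^ (2 ^ n)) ^ 2" by (simp add: Suc.IH)
  also have "\<dots> = (x ^ (2 ^ n)) ^ 2 + (y ^ (2 ^ n)) ^ 2"
    by (simp add: power2_sum two_eq_0_closure)
  finally show ?case by (simp add: power_mult [symmetric] mult.commute)
qed simp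

lemma zero_in_GF2 [simp]: "0 \<in> GF2 n"
  and one_in_GF2 [simp]: "1 \<in> GF2 n"
  and add_in_GF2: "x \<in> GF2 n \<Longrightarrow> y \<in> GF2 n \<Longrightarrow> x + y \<in> GF2 n"
  and mult_in_GF2: "x \<in> GF2 n \<Longrightarrow> y \<in> GF2 n \<Longrightarrow> x * y \<in> GF2 n"
  and uminus_in_GF2: "x \<in> GF2 n \<Longrightarrow> - x \<in> GF2 n"
  and inverse_in_GF2: "x \<in> GF2 n \<Longrightarrow> inverse x \<in> GF2 n"
  by (simp_all add: GF2_def power_two_power_add power_mult_distrib uminus_closure power_inverse)

lemma GF2_mono_dvd: "m dvd n \<Longrightarrow> GF2 m \<subseteq> GF2 n"
proof -
  have "x ^ (2 ^ (m * k)) = x" if "x ^ (2 ^ m) = x" for x :: "bit alg_closure" and k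
  proof (induction k)
    case (Suc k)
    have "x ^ (2 ^ (m * Suc k)) = (x ^ (2 ^ (m * k))) ^ (2 ^ m)"
      by (simp add: power_mult [symmetric] power_add mult.commute)
    then show ?case using Suc.IH that by simp
  qed simp
  then show "m dvd n \<Longrightarrow> GF2 m \<subseteq> GF2 n" by (auto simp: GF2_def dvd_def)
qed

lemma card_GF2:
  assumes "n > 0"
  shows "card (GF2 n) = 2 ^ n" and "finite (GF2 n)"
proof -
  define N :: nat where "N = 2 ^ n"
  have N2: "N \<ge> 2" unfolding N_def using assms by (cases n) auto
  define p :: "bit alg_closure poly" where
    "p = Polynomial.monom 1 N - Polynomial.monom 1 1"
  have deg: "degree p = N"
    unfolding p_def
    by (rule antisym[OF degree_le le_degree]) (use N2 in \<open>auto simp: coeff_diff\<close>)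
  have lc: "lead_coeff p = 1"
    using N2 by (simp add: deg) (simp add: p_def)
  have p0: "p \<noteq> 0" using deg N2 by auto
  have roots: "{x. poly p x = 0} = GF2 n"
    by (auto simp: p_def GF2_def poly_monom N_def)
  have "(of_nat N :: bit alg_closure) = 0"
    unfolding N_def using assms by (simp add: two_eq_0_closure)
  then have pd: "pderiv p = - 1"
    by (simp add: p_def pderiv_diff pderiv_monom)
  obtain A where A: "size A = degree p"
      "p = Polynomial.smult (lead_coeff p) (\<Prod>x\<in>#A. [:-x, 1:])"
    using alg_closed_imp_factorization[OF p0] by blast
  then have pA: "p = (\<Prod>x\<in>#A. [:-x, 1:])" using lc by simp
  have cnt: "count A x = 1" if "x \<in># A" for x
  proof (rule ccontr)
    assume "count A x \<noteq> 1"
    moreover have "count A x > 0" using that by simp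
    ultimately have "count A x \<ge> 2" by linarith
    then have "x \<in># A - {#x#}" by (simp flip: count_greater_zero_iff)
    then obtain C where "A - {#x#} = add_mset x C" by (metis multi_member_split)
    then have "A = add_mset x (add_mset x C)" using that by (metis insert_DiffM)
    then have "p = [:-x, 1:] * ([:-x, 1:] * (\<Prod>x\<in>#C. [:-x, 1:]))"
      using pA by simp
    then have "poly (pderiv p) x = 0" by (simp add: pderiv_mult del: mult_pCons_left)
    then show False by (simp add: pd)
  qed
  have setA: "set_mset A = GF2 n"
    unfolding roots [symmetric] by (subst pA) (auto simp: poly_prod_mset)
  have "size A = (\<Sum>x\<in>set_mset A. count A x)" by (rule size_multiset_overloaded_eq)
  also have "\<dots> = card (set_mset A)" using cnt by simp
  finally show "card (GF2 n) = 2 ^ n" using A deg setA N_def by simp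
  show "finite (GF2 n)" using setA by (metis finite_set_mset)
qed

lemma subfield_type_algebra_iff:
  fixes K :: "'a::field set"
  shows "subfield K ring_of_type_algebra \<longleftrightarrow>
    1 \<in> K \<and> (\<forall>x\<in>K. \<forall>y\<in>K. x + y \<in> K) \<and> (\<forall>x\<in>K. - x \<in> K) \<and>
    (\<forall>x\<in>K. \<forall>y\<in>K. x * y \<in> K) \<and> (\<forall>x\<in>K. inverse x \<in> K)"
    (is "?L \<longleftrightarrow> ?R")
proof -
  let ?T = "ring_of_type_algebra :: 'a ring"
  interpret T: field ?T by (rule field_from_type_algebra)
  have sel [simp]: "carrier ?T = UNIV" "x \<otimes>\<^bsub>?T\<^esub> y = x * y" "x \<oplus>\<^bsub>?T\<^esub> y = x + y"
    "\<one>\<^bsub>?T\<^esub> = 1" "\<zero>\<^bsub>?T\<^esub> = 0" for x y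
    by (simp_all add: ring_of_type_algebra_def)
  have neg [simp]: "\<ominus>\<^bsub>?T\<^esub> x = - x" for x
    by (rule T.minus_equality) auto
  have inv [simp]: "inv\<^bsub>?T\<^esub> x = inverse x" if "x \<noteq> 0" for x
    by (rule T.comm_inv_char) (use that in auto)
  show ?thesis
  proof
    assume L: ?L
    note S = subringE[OF subfieldE(1)[OF L]]
    have "inverse x \<in> K" if "x \<in> K" for x
      using T.subfield_m_inv(1)[OF L, of x] that by (cases "x = 0") auto
    then show ?R using S by auto
  next
    assume R: ?R
    show ?L
    proof (rule T.subfieldI')
      show "subring K ?T" by (rule T.subringI) (use R in auto)
      show "inv\<^bsub>?T\<^esub> k \<in> K" if "k \<in> K - {\<zero>\<^bsub>?T\<^esub>}" for k
        using that R by auto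
    qed
  qed
qed

lemma subfield_card_iff_GF2:
  assumes "n > 0"
  shows "subfield K ring_of_type_algebra \<and> card K = 2 ^ n \<longleftrightarrow> K = GF2 n"
proof
  assume "K = GF2 n"
  then show "subfield K ring_of_type_algebra \<and> card K = 2 ^ n"
    using card_GF2[OF assms]
    by (simp add: subfield_type_algebra_iff add_in_GF2 mult_in_GF2 uminus_in_GF2 inverse_in_GF2)
next
  assume asm: "subfield K ring_of_type_algebra \<and> card K = 2 ^ n"
  then have fin: "finite K" by (metis card.infinite power_not_zero zero_neq_numeral)
  have one: "1 \<in> K" and mult: "\<And>x y. x \<in> K \<Longrightarrow> y \<in> K \<Longrightarrow> x * y \<in> K"
    and add: "\<And>x y. x \<in> K \<Longrightarrow> y \<in> K \<Longrightarrow> x + y \<in> K" and neg: "\<And>x. x \<in> K \<Longrightarrow> - x \<in> K"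
    using asm by (auto simp: subfield_type_algebra_iff)
  have zero: "0 \<in> K" using add[OF one neg[OF one]] by simp
  have "x \<in> GF2 n" if x: "x \<in> K" for x
  proof (cases "x = 0")
    case False
    let ?U = "K - {0}"
    have cU: "Suc (card ?U) = 2 ^ n" using asm fin zero by (metis card_Suc_Diff1)
    have inj: "inj_on ((*) x) ?U" using False by (auto simp: inj_on_def)
    have "(*) x ` ?U \<subseteq> ?U" using False x mult by auto
    then have "(*) x ` ?U = ?U"
      using inj fin by (intro card_subset_eq) (auto simp: card_image)
    then have "\<Prod>?U = (\<Prod>u\<in>?U. x * u)"
      using prod.reindex[OF inj, of "\<lambda>u. u"] by simp
    also have "\<dots> = x ^ card ?U * \<Prod>?U" by (simp add: prod.distrib)
    finally have "x ^ card ?U = 1" using fin by simp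
    then have "x ^ Suc (card ?U) = x" by simp
    then show ?thesis unfolding cU by (simp add: GF2_def)
  qed simp
  then show "K = GF2 n"
    using card_GF2[OF assms] asm by (intro card_subset_eq) auto
qed

end

theory Submission
  imports Defs
begin

text \<open>
  Write \<open>K\<close> and \<open>L\<close> for the fields with \<open>2^m\<close> and \<open>2^(2*m)\<close> elements, \<open>\<sigma>\<close> for \<open>x \<mapsto> x^q\<close> (also
  coordinatewise) and \<open>A\<close> for the linear map \<open>(x, y, z) \<mapsto> (y, z, x + a z)\<close>.  Up to a cyclic shift of
  the coordinates, the function is the cross product (without signs, in characteristic 2)
  \<open>G(v) = A v \<times> \<sigma>(v)\<close>.  This ties \<open>G\<close> to the semilinear map \<open>\<phi> = A\<inverse> \<sigma>\<close> on \<open>K^3\<close>: a vector is a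
  zero of \<open>G\<close> iff it is zero or spans a \<open>\<phi>\<close>-invariant line, and the roots of \<open>P_a\<close> are the planes
  that \<open>\<phi>\<close> leaves invariant: \<open>t\<close> is a root iff the plane with normal vector \<open>(1, t^(-q), t)\<close> is
  invariant.  Since \<open>K\<close> is finite, only the injectivity of \<open>G\<close> is at stake.

  Suppose that \<open>P_a\<close> has no root in \<open>K\<close>, and let \<open>G(v) = G(v') = b\<close>.  If \<open>b \<noteq> 0\<close> and \<open>v, v'\<close> are
  independent, then \<open>A v, A v'\<close> and \<open>\<sigma>(v), \<sigma>(v')\<close> both span the plane orthogonal to \<open>b\<close>, so \<open>\<phi>\<close>
  preserves the span of \<open>v, v'\<close>, and there is a root (\<open>invariant_plane_gives_root\<close>).  If
  \<open>v' = u v\<close>, then \<open>u^(q+1) = 1\<close>, which forces \<open>u = 1\<close> because \<open>m\<close> is odd and prime to \<open>i\<close>.  If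
  \<open>b = 0\<close>, a nonzero \<open>v\<close> would span an invariant line.  An invariant line forces an invariant plane:
  after scaling, it is a zero in \<open>K\<close> of a linearized polynomial whose adjoint for the trace form
  encodes the invariant planes, and a linear map on a finite space is injective iff its adjoint is
  (\<open>kernel_gives_adjoint_kernel\<close>).

  Conversely, a root \<open>t\<close> in \<open>K\<close> gives an invariant plane, which \<open>G\<close> maps into a line, so \<open>G\<close> is not
  injective by counting (\<open>root_imp_not_inj\<close>).  A root in \<open>L\<close> outside \<open>K\<close> has a conjugate, and the two
  invariant planes over \<open>L\<close> meet in an invariant line that is defined over \<open>K\<close>, on which \<open>G\<close>
  vanishes (\<open>conjugate_roots_imp_not_inj\<close>).  No estimate for large \<open>m\<close> enters, so \<open>M = 0\<close> will do.
\<close>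

section \<open>Frobenius powers and the trace\<close>

definition frob :: "nat \<Rightarrow> bit alg_closure \<Rightarrow> bit alg_closure" where
  "frob n x = x ^ 2 ^ n"

lemma frob_0 [simp]: "frob n 0 = 0"
  and frob_1 [simp]: "frob n 1 = 1"
  and frob_add: "frob n (x + y) = frob n x + frob n y"
  and frob_mult: "frob n (x * y) = frob n x * frob n y"
  and frob_inverse: "frob n (inverse x) = inverse (frob n x)"
  and frob_divide: "frob n (x / y) = frob n x / frob n y"
  and frob_eq_0_iff [simp]: "frob n x = 0 \<longleftrightarrow> x = 0"
  by (simp_all add: frob_def power_two_power_add power_mult_distrib power_inverse power_divide)

lemma frob_frob: "frob j (frob k x) = frob (j + k) x"
  by (simp add: frob_def power_add power_mult [symmetric] mult.commute)

lemma frob_commute: "frob j (frob k x) = frob k (frob j x)"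
  by (simp add: frob_frob add.commute)

lemma GF2_iff_frob: "x \<in> GF2 n \<longleftrightarrow> frob n x = x"
  by (simp add: GF2_def frob_def)

lemma frob_in_GF2: "x \<in> GF2 n \<Longrightarrow> frob k x \<in> GF2 n"
  by (simp add: GF2_iff_frob frob_commute [of n])

lemma divide_in_GF2: "x \<in> GF2 n \<Longrightarrow> y \<in> GF2 n \<Longrightarrow> x / y \<in> GF2 n"
  by (simp add: GF2_iff_frob frob_divide)

lemmas GF2_closed = add_in_GF2 mult_in_GF2 frob_in_GF2 divide_in_GF2

lemma add_self [simp]: "x + x = (0 :: bit alg_closure)"
  using uminus_closure [of x] by (metis add.right_inverse)

lemma add_self_left [simp]: "x + (x + y) = (y :: bit alg_closure)"
  by (simp flip: add.assoc)

lemma add_eq_0_iff_eq: "x + y = 0 \<longleftrightarrow> x = (y :: bit alg_closure)"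
  by (metis add.commute add_self_left add_self add_0_right)

text \<open>
  By Bezout, a common fixed point of the \<open>k\<close>-th and the \<open>m\<close>-th power of the Frobenius map is fixed by
  the Frobenius map itself.
\<close>

lemma GF2_Int_coprime:
  assumes "x \<in> GF2 k" "x \<in> GF2 m" "coprime k m" "k > 0"
  shows "x = 0 \<or> x = 1"
proof -
  obtain u v where uv: "k * u = m * v + 1"
    using bezout_nat [of k m] assms by (auto simp: coprime_iff_gcd_eq_1)
  have "x \<in> GF2 (k * u)" "x \<in> GF2 (m * v)"
    using GF2_mono_dvd [of k "k * u"] GF2_mono_dvd [of m "m * v"] assms by auto
  then have "frob 1 x = x"
    unfolding GF2_iff_frob by (metis uv frob_frob add.commute)
  then have "x * x = x * 1"
    by (simp add: frob_def power2_eq_square)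
  then show ?thesis by (simp only: mult_cancel_left)
qed

text \<open>
  The endomorphism \<open>u \<mapsto> u^(q-1)\<close> of the finite group \<open>K - {0}\<close> is injective, hence onto.  It serves to
  scale a vector that a semilinear map fixes up to a factor into one that is fixed exactly.
\<close>

lemma frob_quotient_surj:
  assumes "coprime i m" "i > 0" "m > 0" "c \<in> GF2 m" "c \<noteq> 0"
  obtains u where "u \<in> GF2 m" "u \<noteq> 0" "frob i u = c * u"
proof -
  let ?U = "GF2 m - {0}"
  let ?h = "\<lambda>u. frob i u / u"
  have "inj_on ?h ?U"
  proof (rule inj_onI)
    fix u v assume uv: "u \<in> ?U" "v \<in> ?U" "?h u = ?h v"
    then have "frob i (u / v) = u / v" by (auto simp: frob_divide field_simps)
    then have "u / v = 0 \<or> u / v = 1"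
      using uv assms by (intro GF2_Int_coprime [of _ i m]) (auto simp: GF2_iff_frob frob_divide)
    then show "u = v" using uv by auto
  qed
  moreover have "?h ` ?U \<subseteq> ?U" by (auto intro: GF2_closed)
  ultimately have "?h ` ?U = ?U"
    using card_GF2(2) [OF \<open>m > 0\<close>] by (intro endo_inj_surj) auto
  moreover have "c \<in> ?U" using assms by simp
  ultimately have "c \<in> ?h ` ?U" by (simp only:)
  then obtain u where "u \<in> ?U" "?h u = c" by blast
  then show ?thesis by (intro that [of u]) auto
qed

text \<open>
  On the field with \<open>2^m\<close> elements this is the absolute trace.
\<close>

definition trace2 :: "nat \<Rightarrow> bit alg_closure \<Rightarrow> bit alg_closure" where
  "trace2 m x = (\<Sum>j<m. frob j x)"

lemma trace2_add: "trace2 m (x + y) = trace2 m x + trace2 m y"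
  by (simp add: trace2_def frob_add sum.distrib)

lemma trace2_0 [simp]: "trace2 m 0 = 0"
  by (simp add: trace2_def)

lemma trace2_frob:
  assumes "x \<in> GF2 m"
  shows "trace2 m (frob k x) = trace2 m x"
proof (induction k)
  case 0
  show ?case by (simp add: frob_def)
next
  case (Suc k)
  define y where "y = frob k x"
  have y: "frob m y = y" using assms by (simp add: y_def frob_commute [of m] GF2_iff_frob)
  have "trace2 m (frob 1 y) = (\<Sum>j<m. frob (Suc j) y)"
    by (simp add: trace2_def frob_frob)
  also have "\<dots> + frob 0 y = (\<Sum>j<Suc m. frob j y)"
    by (simp add: sum.lessThan_Suc_shift add.commute del: sum.lessThan_Suc)
  also have "\<dots> = trace2 m y + frob 0 y"
    by (simp add: trace2_def y) (simp add: frob_def)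
  finally have "trace2 m (frob 1 y) = trace2 m y" by simp
  then show ?case using Suc.IH by (simp add: y_def frob_frob)
qed

text \<open>
  The trace is a nonzero polynomial of degree \<open>2^(m-1)\<close>, too small to vanish at \<open>2^m\<close> points.
\<close>

lemma trace2_nonzero:
  assumes "m > 0"
  shows "\<exists>x\<in>GF2 m. trace2 m x \<noteq> 0"
proof (rule ccontr)
  assume *: "\<not> ?thesis"
  define p :: "bit alg_closure poly" where "p = (\<Sum>j<m. Polynomial.monom 1 (2 ^ j))"
  have poly_p: "poly p x = trace2 m x" for x
    by (simp add: p_def trace2_def poly_sum poly_monom frob_def)
  have "coeff p 1 = (\<Sum>j<m. if j = 0 then 1 else 0)"
    unfolding p_def coeff_sum by (intro sum.cong) auto
  also have "\<dots> = 1" using assms by simp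
  finally have p0: "p \<noteq> 0" by auto
  have "degree p \<le> 2 ^ (m - 1)"
    unfolding p_def
  proof (intro degree_sum_le)
    show "degree (Polynomial.monom (1 :: bit alg_closure) (2 ^ j)) \<le> 2 ^ (m - 1)"
      if "j \<in> {..<m}" for j
      unfolding degree_monom_eq [OF one_neq_zero]
      using that by (intro power_increasing) auto
  qed simp
  also have "\<dots> < 2 ^ m" using assms by (intro power_strict_increasing) auto
  also have "\<dots> = card (GF2 m)" using card_GF2 [OF assms] by simp
  also have "\<dots> \<le> card {x. poly p x = 0}"
    using * poly_roots_finite [OF p0] by (intro card_mono) (auto simp: poly_p)
  also have "\<dots> \<le> degree p" using card_poly_roots_bound [OF p0] .
  finally show False by simp
qed

section \<open>Duality for the linearized polynomials\<close>

text \<open>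
  All exponents are absorbed into the field automorphism \<open>\<sigma>\<close>: a root is a \<open>t\<close> with
  \<open>\<sigma>(\<sigma>(t) t) (t + a) = 1\<close>.
\<close>

lemma poly_P:
  "poly (P_poly (2 ^ i) a) t = frob i (frob i t * t) * (t + a) + 1"
proof -
  have sq: "(2 ^ i :: nat)\<^sup>2 = 2 ^ (i + i)" by (simp add: power2_eq_square power_add)
  have pw: "t ^ (2 ^ (i + i) + 2 ^ i) = frob i (frob i t * t)"
    unfolding frob_mult frob_frob unfolding frob_def by (rule power_add)
  have "poly (P_poly (2 ^ i) a) t
      = t ^ (2 ^ (i + i) + 2 ^ i) * t + a * t ^ (2 ^ (i + i) + 2 ^ i) + 1"
    by (simp add: P_poly_def poly_monom sq mult.commute [of t])
  then show ?thesis unfolding pw by (simp add: algebra_simps)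
qed

lemma divide_mult_cancel_right:
  "p \<noteq> 0 \<Longrightarrow> p / r * (s / p) = s / (r :: 'a :: field)"
  by simp

text \<open>
  The substitution \<open>t = w^(1-q)\<close> linearizes \<open>P_a\<close>: it turns \<open>w^(q^3) P_a(t)\<close> into
  \<open>w + a w^q + w^(q^3)\<close>.
\<close>

lemma adjoint_kernel_gives_root:
  assumes "w \<noteq> 0" "w + a * frob i w + frob i (frob i (frob i w)) = 0"
  shows "poly (P_poly (2 ^ i) a) (w / frob i w) = 0"
proof -
  let ?w1 = "frob i w" and ?w3 = "frob i (frob i (frob i w))"
  have "frob i (frob i (w / ?w1) * (w / ?w1)) = ?w1 / ?w3"
    using assms(1) by (simp add: frob_divide)
  moreover have "w / ?w1 + a = (w + a * ?w1) / ?w1"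
    using assms(1) by (simp add: add_divide_distrib)
  ultimately have "poly (P_poly (2 ^ i) a) (w / ?w1) = ?w1 / ?w3 * ((w + a * ?w1) / ?w1) + 1"
    unfolding poly_P by (simp only:)
  also have "\<dots> = (w + a * ?w1) / ?w3 + 1" using assms(1) by (subst divide_mult_cancel_right) auto
  also have "w + a * ?w1 = ?w3" using assms(2) by (simp only: add_eq_0_iff_eq)
  finally show ?thesis using assms(1) by simp
qed

text \<open>
  The two linearized maps \<open>\<ell>(x) = x^(q^3) + a x^(q^2) + x\<close> and \<open>D(w) = w + a w^q + w^(q^3)\<close> are
  adjoint up to twists by Frobenius powers: by the invariance of the trace under Frobenius,
  \<open>Tr(x^(q^2) D(w)) = Tr(w^q \<ell>(x))\<close>.  If \<open>D\<close> had trivial kernel, it would be onto, and a zero \<open>x\<close> of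
  \<open>\<ell>\<close> would be orthogonal to all of \<open>K\<close>.
\<close>

lemma kernel_gives_adjoint_kernel:
  assumes m: "m > 0" and a: "a \<in> GF2 m" and x: "x \<in> GF2 m" "x \<noteq> 0"
    and ker: "frob i (frob i (frob i x)) + a * frob i (frob i x) + x = 0"
  shows "\<exists>w\<in>GF2 m. w \<noteq> 0 \<and> w + a * frob i w + frob i (frob i (frob i w)) = 0"
proof (rule ccontr)
  assume none: "\<not> ?thesis"
  define D where "D w = w + a * frob i w + frob i (frob i (frob i w))" for w
  define x2 where "x2 = frob i (frob i x)"
  have x2: "x2 \<in> GF2 m" "x2 \<noteq> 0" using x by (auto simp: x2_def intro: GF2_closed)
  have D_add: "D (u + v) = D u + D v" for u v
    by (simp add: D_def frob_add algebra_simps)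
  have "inj_on D (GF2 m)"
  proof (rule inj_onI)
    fix u v assume uv: "u \<in> GF2 m" "v \<in> GF2 m" "D u = D v"
    then have "D (u + v) = 0" by (simp add: D_add)
    then have "u + v = 0" using none uv unfolding D_def by (blast intro: GF2_closed)
    then show "u = v" by (simp add: add_eq_0_iff_eq)
  qed
  moreover have "D ` GF2 m \<subseteq> GF2 m" using a by (auto simp: D_def intro: GF2_closed)
  ultimately have surj: "D ` GF2 m = GF2 m"
    using card_GF2(2) [OF m] by (intro endo_inj_surj) auto
  have orth: "trace2 m (x2 * D w) = 0" if w: "w \<in> GF2 m" for w
  proof -
    have "trace2 m (x2 * D w) =
        trace2 m (x2 * w) + trace2 m (x2 * a * frob i w)
        + trace2 m (x2 * frob i (frob i (frob i w)))"
      by (simp add: D_def trace2_add algebra_simps)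
    also have "trace2 m (x2 * w) = trace2 m (frob i (x2 * w))"
      using w x2 by (intro trace2_frob [symmetric] GF2_closed)
    also have "trace2 m (x2 * frob i (frob i (frob i w)))
        = trace2 m (frob (i + i) (x * frob i w))"
      by (simp add: x2_def frob_mult frob_frob add_ac)
    also have "\<dots> = trace2 m (x * frob i w)"
      using w x by (intro trace2_frob GF2_closed)
    also have "trace2 m (frob i (x2 * w)) + trace2 m (x2 * a * frob i w) + trace2 m (x * frob i w)
        = trace2 m (frob i w * (frob i x2 + a * x2 + x))"
      by (simp add: trace2_add [symmetric] frob_mult algebra_simps)
    also have "frob i x2 + a * x2 + x = 0" using ker by (simp add: x2_def)
    finally show ?thesis by simp
  qed
  obtain y where y: "y \<in> GF2 m" "trace2 m y \<noteq> 0" using trace2_nonzero [OF m] by blast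
  obtain w where "w \<in> GF2 m" "D w = y / x2"
    using surj divide_in_GF2 [OF y(1) x2(1)] by (metis imageE)
  then show False using orth [of w] y x2 by simp
qed

section \<open>The function as a cross product\<close>

text \<open>
  The components are the second, third and first entry of the cross product of \<open>(y, z, x + a z)\<close> with
  \<open>(x^q, y^q, z^q)\<close>.
\<close>

lemma G_eq:
  "G_a11a (2 ^ i) a (x, y, z) =
    (frob i x * (x + a * z) + frob i z * y,
     frob i x * z + frob i y * y,
     frob i y * (x + a * z) + frob i z * z)"
  by (simp add: G_a11a_def frob_def algebra_simps)

lemma G_in_GF2:
  assumes "a \<in> GF2 m"
  shows "G_a11a (2 ^ i) a ` (GF2 m \<times> GF2 m \<times> GF2 m) \<subseteq> GF2 m \<times> GF2 m \<times> GF2 m"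
  using assms by (auto simp: G_eq intro!: GF2_closed)

lemma G_scale:
  "G_a11a (2 ^ i) a (u * x, u * y, u * z) =
    (case G_a11a (2 ^ i) a (x, y, z) of
      (g1, g2, g3) \<Rightarrow> (frob i u * u * g1, frob i u * u * g2, frob i u * u * g3))"
  by (simp add: G_eq frob_mult algebra_simps)

text \<open>
  The first three hypotheses say that the cross product of the two vectors vanishes.
\<close>

lemma parallel_imp_scalar:
  assumes "x2 * y3 + x3 * y2 = 0" "x3 * y1 + x1 * y3 = 0" "x1 * y2 + x2 * y1 = 0"
    and "x1 \<in> GF2 m" "x2 \<in> GF2 m" "x3 \<in> GF2 m" "y1 \<in> GF2 m" "y2 \<in> GF2 m" "y3 \<in> GF2 m"
    and "(x1, x2, x3) \<noteq> (0, 0, 0)"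
  obtains c where "c \<in> GF2 m" "y1 = c * x1" "y2 = c * x2" "y3 = c * x3"
proof -
  have eqs: "x2 * y3 = x3 * y2" "x3 * y1 = x1 * y3" "x1 * y2 = x2 * y1"
    using assms(1-3) by (simp_all add: add_eq_0_iff_eq)
  consider "x1 \<noteq> 0" | "x2 \<noteq> 0" | "x3 \<noteq> 0" using assms(10) by auto
  then show ?thesis
  proof cases
    case 1 then show ?thesis
      by (intro that [of "y1 / x1"])
        (use eqs assms(4-9) in \<open>auto simp: field_simps intro: GF2_closed\<close>)
  next
    case 2 then show ?thesis
      by (intro that [of "y2 / x2"])
        (use eqs assms(4-9) in \<open>auto simp: field_simps intro: GF2_closed\<close>)
  next
    case 3 then show ?thesis
      by (intro that [of "y3 / x3"])
        (use eqs assms(4-9) in \<open>auto simp: field_simps intro: GF2_closed\<close>)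
  qed
qed

text \<open>
  The vector \<open>n\<close> is \<open>u \<times> v\<close>, and \<open>b \<times> (u \<times> v) = (b \<bullet> v) u - (b \<bullet> u) v\<close> vanishes.
\<close>

lemma orthogonal_imp_parallel:
  assumes "(b1, b2, b3) \<noteq> (0, 0, 0 :: bit alg_closure)"
    and u: "b1 * u1 + b2 * u2 + b3 * u3 = 0" and v: "b1 * v1 + b2 * v2 + b3 * v3 = 0"
    and n: "n1 = u2 * v3 + u3 * v2" "n2 = u3 * v1 + u1 * v3" "n3 = u1 * v2 + u2 * v1"
  shows "\<exists>c. n1 = c * b1 \<and> n2 = c * b2 \<and> n3 = c * b3"
proof -
  have "b2 * n3 + b3 * n2 = u1 * (b1 * v1 + b2 * v2 + b3 * v3) + v1 * (b1 * u1 + b2 * u2 + b3 * u3)"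
    "b3 * n1 + b1 * n3 = u2 * (b1 * v1 + b2 * v2 + b3 * v3) + v2 * (b1 * u1 + b2 * u2 + b3 * u3)"
    "b1 * n2 + b2 * n1 = u3 * (b1 * v1 + b2 * v2 + b3 * v3) + v3 * (b1 * u1 + b2 * u2 + b3 * u3)"
    unfolding n by (simp_all add: algebra_simps)
  then have eqs: "b2 * n3 = b3 * n2" "b3 * n1 = b1 * n3" "b1 * n2 = b2 * n1"
    unfolding u v by (simp_all add: add_eq_0_iff_eq)
  consider "b1 \<noteq> 0" | "b2 \<noteq> 0" | "b3 \<noteq> 0" using assms(1) by auto
  then show ?thesis
  proof cases
    case 1 then show ?thesis
      by (intro exI [of _ "n1 / b1"]) (use eqs in \<open>auto simp: field_simps\<close>)
  next
    case 2 then show ?thesis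
      by (intro exI [of _ "n2 / b2"]) (use eqs in \<open>auto simp: field_simps\<close>)
  next
    case 3 then show ?thesis
      by (intro exI [of _ "n3 / b3"]) (use eqs in \<open>auto simp: field_simps\<close>)
  qed
qed

section \<open>Invariant points and invariant planes\<close>

text \<open>
  A zero of \<open>G\<close> satisfies \<open>\<sigma>(v) = c (A v)\<close>.  Scaled so that \<open>c = 1\<close>, it has the form
  \<open>(x, x^q, x^(q^2))\<close> with \<open>x^(q^3) = x + a x^(q^2)\<close>, and trace duality applies.
\<close>

lemma invariant_point_gives_root:
  assumes cop: "coprime i m" "i > 0" "m > 0" and a: "a \<in> GF2 m"
    and K: "x \<in> GF2 m" "y \<in> GF2 m" "z \<in> GF2 m" and nz: "(x, y, z) \<noteq> (0, 0, 0)"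
    and G: "G_a11a (2 ^ i) a (x, y, z) = (0, 0, 0)"
  shows "\<exists>t\<in>GF2 m. poly (P_poly (2 ^ i) a) t = 0"
proof -
  have Anz: "(y, z, x + a * z) \<noteq> (0, 0, 0)" using nz by auto
  obtain c where c: "c \<in> GF2 m" "frob i x = c * y" "frob i y = c * z" "frob i z = c * (x + a * z)"
    by (rule parallel_imp_scalar [of z "frob i z" "x + a * z" "frob i y" "frob i x" y m])
      (use G K a Anz in \<open>auto simp: G_eq algebra_simps intro!: GF2_closed\<close>)
  have c0: "c \<noteq> 0" using c nz by auto
  obtain u where u: "u \<in> GF2 m" "u \<noteq> 0" "frob i u = inverse c * u"
    using frob_quotient_surj [OF cop, of "inverse c"] c c0 inverse_in_GF2 by auto
  have f: "frob i (u * x) = u * y" "frob i (u * y) = u * z" "frob i (u * z) = u * (x + a * z)"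
    using c c0 by (simp_all add: frob_mult u)
  have "x \<noteq> 0" using c c0 nz by auto
  moreover have "frob i (frob i (frob i (u * x))) + a * frob i (frob i (u * x)) + u * x = 0"
    unfolding f by (simp add: algebra_simps)
  ultimately obtain w where "w \<in> GF2 m" "w \<noteq> 0"
      "w + a * frob i w + frob i (frob i (frob i w)) = 0"
    using kernel_gives_adjoint_kernel [OF \<open>m > 0\<close> a, of "u * x" i] u K
    by (auto intro: GF2_closed)
  then show ?thesis
    using adjoint_kernel_gives_root by (blast intro: GF2_closed)
qed

text \<open>
  If \<open>v \<times> v' = n\<close>, then \<open>A v \<times> A v' = (n2, n3 + a n1, n1)\<close>.  So the hypotheses say that the plane with
  normal vector \<open>n\<close> is invariant under \<open>A\<inverse> \<sigma>\<close>.  With \<open>n1 = 1\<close>, eliminating \<open>n2\<close> and \<open>c\<close> leaves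
  \<open>P_a(n3) = 0\<close>.
\<close>

lemma invariant_plane_gives_root:
  assumes K: "n1 \<in> GF2 m" "n3 \<in> GF2 m" and nz: "(n1, n2, n3) \<noteq> (0, 0, 0)"
    and inv: "frob i n1 = c * n2" "frob i n2 = c * (n3 + a * n1)" "frob i n3 = c * n1"
  shows "\<exists>t\<in>GF2 m. poly (P_poly (2 ^ i) a) t = 0"
proof
  have n1: "n1 \<noteq> 0"
  proof
    assume "n1 = 0"
    then show False using inv nz by auto
  qed
  then have c: "c \<noteq> 0" "n2 \<noteq> 0" using inv by auto
  then have "n3 + a * n1 \<noteq> 0" using inv(2) by auto
  have "frob i (n3 / n1) = n1 / n2" using c by (simp add: frob_divide inv)
  then have "frob i (frob i (n3 / n1) * (n3 / n1)) = frob i (n3 / n2)"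
    using n1 by simp
  also have "\<dots> = n1 / (n3 + a * n1)" using c by (simp add: frob_divide inv)
  finally have "frob i (frob i (n3 / n1) * (n3 / n1)) = n1 / (n3 + a * n1)" .
  moreover have "n3 / n1 + a = (n3 + a * n1) / n1" using n1 by (simp add: add_divide_distrib)
  ultimately have "poly (P_poly (2 ^ i) a) (n3 / n1)
      = n1 / (n3 + a * n1) * ((n3 + a * n1) / n1) + 1"
    unfolding poly_P by (simp only:)
  also have "\<dots> = 0"
    using n1 \<open>n3 + a * n1 \<noteq> 0\<close> by (subst divide_mult_cancel_right) auto
  finally show "poly (P_poly (2 ^ i) a) (n3 / n1) = 0" .
  show "n3 / n1 \<in> GF2 m" using K by (rule divide_in_GF2 [rotated])
qed

section \<open>Injectivity without roots\<close>

text \<open>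
  Two vectors with the same nonzero image \<open>b\<close> span an invariant plane unless they are proportional,
  as all of \<open>A v\<close>, \<open>A v'\<close>, \<open>\<sigma>(v)\<close>, \<open>\<sigma>(v')\<close> are orthogonal to \<open>b\<close>.
\<close>

lemma no_root_imp_inj:
  assumes cop: "coprime i m" "i > 0" "odd m" and a: "a \<in> GF2 m"
    and no_root: "\<not> (\<exists>t\<in>GF2 m. poly (P_poly (2 ^ i) a) t = 0)"
  shows "inj_on (G_a11a (2 ^ i) a) (GF2 m \<times> GF2 m \<times> GF2 m)"
proof (rule inj_onI)
  have m: "m > 0" using cop by (cases m) auto
  fix v v' assume "v \<in> GF2 m \<times> GF2 m \<times> GF2 m" "v' \<in> GF2 m \<times> GF2 m \<times> GF2 m"
    and eq: "G_a11a (2 ^ i) a v = G_a11a (2 ^ i) a v'"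
  then obtain x y z x' y' z' where v: "v = (x, y, z)" "v' = (x', y', z')"
    and K: "x \<in> GF2 m" "y \<in> GF2 m" "z \<in> GF2 m" and K': "x' \<in> GF2 m" "y' \<in> GF2 m" "z' \<in> GF2 m"
    by auto
  obtain g1 g2 g3 where g: "G_a11a (2 ^ i) a (x, y, z) = (g1, g2, g3)" by (metis prod_cases3)
  have g': "G_a11a (2 ^ i) a (x', y', z') = (g1, g2, g3)" using g eq v by simp
  note zero = invariant_point_gives_root [OF cop(1,2) m a]
  show "v = v'"
  proof (cases "(g1, g2, g3) = (0, 0, 0)")
    case True
    then have "(x, y, z) = (0, 0, 0)" "(x', y', z') = (0, 0, 0)"
      using zero [OF K] zero [OF K'] g g' no_root by metis+
    then show ?thesis using v by simp
  next
    case False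
    then have b: "(g3, g1, g2) \<noteq> (0, 0, 0)" by auto
    \<comment> \<open>\<open>b = (g3, g1, g2)\<close> is \<open>A v \<times> \<sigma>(v)\<close> in its natural order, and \<open>n = v \<times> v'\<close>.\<close>
    define n1 n2 n3 where "n1 = y * z' + z * y'" and "n2 = z * x' + x * z'" and "n3 = x * y' + y * x'"
    note n = this
    have "g3 * y + g1 * z + g2 * (x + a * z) = 0" "g3 * frob i x + g1 * frob i y + g2 * frob i z = 0"
      using g by (auto simp: G_eq algebra_simps)
    note o1 = this
    have "g3 * y' + g1 * z' + g2 * (x' + a * z') = 0"
      "g3 * frob i x' + g1 * frob i y' + g2 * frob i z' = 0"
      using g' by (auto simp: G_eq algebra_simps)
    note o2 = this
    obtain d where d: "n2 = d * g3" "n3 + a * n1 = d * g1" "n1 = d * g2"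
      using orthogonal_imp_parallel [OF b o1(1) o2(1) refl refl refl]
      by (auto simp: n algebra_simps)
    obtain e where e: "frob i n1 = e * g3" "frob i n2 = e * g1" "frob i n3 = e * g2"
      using orthogonal_imp_parallel [OF b o1(2) o2(2) refl refl refl]
      by (auto simp: n frob_add frob_mult)
    show ?thesis
    proof (cases "(n1, n2, n3) = (0, 0, 0)")
      case False
      have "d \<noteq> 0" using d False by auto
      then have "frob i n1 = e / d * n2" "frob i n2 = e / d * (n3 + a * n1)" "frob i n3 = e / d * n1"
        by (simp_all only: e) (simp add: d(1), simp add: d(2), simp add: d(3))
      then have "\<exists>t\<in>GF2 m. poly (P_poly (2 ^ i) a) t = 0"
        using K K' False by (intro invariant_plane_gives_root [of n1 m n3 n2 i "e / d" a])
          (auto simp only: n intro!: GF2_closed)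
      then show ?thesis using no_root by simp
    next
      case True
      have "(x, y, z) \<noteq> (0, 0, 0)"
      proof
        assume "(x, y, z) = (0, 0, 0)"
        then show False using g b by (auto simp: G_eq)
      qed
      then obtain u where u: "u \<in> GF2 m" "x' = u * x" "y' = u * y" "z' = u * z"
        using parallel_imp_scalar [of y z' z y' x' x m] True K K' unfolding n by auto
      \<comment> \<open>From \<open>u^(q+1) = 1\<close> it follows that \<open>u^(q^2) = u\<close>; and \<open>2 * i\<close> is prime to the odd \<open>m\<close>.\<close>
      have "(frob i u * u * g1, frob i u * u * g2, frob i u * u * g3) = (g1, g2, g3)"
        using g' u g by (simp add: G_scale)
      then have uu: "frob i u * u = 1" using b by auto
      then have "frob i (frob i u) * frob i u = frob i u * u"
        by (metis frob_mult frob_1)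
      then have "frob i (frob i u) = u" using uu by (auto simp: mult.commute)
      then have "u \<in> GF2 (2 * i)" by (simp add: GF2_iff_frob frob_frob mult_2)
      then have "u = 0 \<or> u = 1" using u(1) cop by (intro GF2_Int_coprime [of _ "2 * i" m]) auto
      then have "u = 1" using uu by auto
      then show ?thesis using u v by simp
    qed
  qed
qed

section \<open>Collisions from a root\<close>

lemma root_imp_nonzero:
  fixes t :: "bit alg_closure"
  assumes "poly (P_poly (2 ^ i) a) t = 0"
  shows "t \<noteq> 0"
  using assms unfolding poly_P by auto

lemma root_frob:
  assumes "poly (P_poly (2 ^ i) a) t = 0"
  shows "frob i (inverse (frob i t)) = frob i t * (t + a)"
proof -
  have "frob i (frob i t) * (frob i t * (t + a)) = 1"
    using assms by (simp add: poly_P frob_mult mult_ac add_eq_0_iff_eq)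
  then show ?thesis
    by (metis frob_inverse inverse_unique)
qed

text \<open>
  On the plane \<open>x + r y + t z = 0\<close> with \<open>r = t^(-q)\<close>, both \<open>A v\<close> and \<open>\<sigma>(v)\<close> are orthogonal to
  \<open>(r, t + a, 1)\<close>.  Their cross product is therefore a multiple of that vector, so \<open>G\<close> maps the
  \<open>2^(2*m)\<close> points of the plane to at most \<open>2^m\<close> values.
\<close>

lemma root_imp_not_inj:
  assumes m: "m > 0" and a: "a \<in> GF2 m"
    and t: "t \<in> GF2 m" "poly (P_poly (2 ^ i) a) t = 0"
  shows "\<not> inj_on (G_a11a (2 ^ i) a) (GF2 m \<times> GF2 m \<times> GF2 m)"
proof
  assume inj: "inj_on (G_a11a (2 ^ i) a) (GF2 m \<times> GF2 m \<times> GF2 m)"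
  define r where "r = inverse (frob i t)"
  have t0: "t \<noteq> 0" using root_imp_nonzero [OF t(2)] .
  have r: "r \<in> GF2 m" "frob i r = frob i t * (t + a)" "r * frob i t = 1"
    using t root_frob [OF t(2)] t0 by (auto simp: r_def intro: inverse_in_GF2 GF2_closed)
  define p where "p = (\<lambda>(y, z). (r * y + t * z, y, z))"
  define h where "h = (\<lambda>v. fst (snd (G_a11a (2 ^ i) a v)))"
  have on_line: "G_a11a (2 ^ i) a (p (y, z)) =
      ((t + a) * h (p (y, z)), h (p (y, z)), r * h (p (y, z)))" for y z
  proof -
    define fx fy fz c where "fx = frob i (r * y + t * z)" and "fy = frob i y" and "fz = frob i z" and "c = t + a"
    note defs = this
    have "r * fx = (r * frob i t) * (c * fy + fz)"
      by (simp add: defs frob_add frob_mult r(2) algebra_simps)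
    then have fx_eq: "r * fx = c * fy + fz" by (simp add: r(3))
    have "fx * (r * y + c * z) + fz * y = (r * fx) * y + c * fx * z + fz * y"
      by (simp add: algebra_simps)
    also have "\<dots> = c * (fx * z + fy * y)"
      unfolding fx_eq by (simp add: algebra_simps)
    finally have G1: "fx * (r * y + c * z) + fz * y = c * (fx * z + fy * y)" .
    have "fy * (r * y + c * z) + fz * z = r * fy * y + (c * fy + fz) * z"
      by (simp add: algebra_simps)
    also have "\<dots> = r * (fx * z + fy * y)"
      unfolding fx_eq [symmetric] by (simp add: algebra_simps)
    finally have G3: "fy * (r * y + c * z) + fz * z = r * (fx * z + fy * y)" .
    have p_y: "r * y + t * z + a * z = r * y + c * z" by (simp add: defs algebra_simps)
    show ?thesis
      using G1 G3 by (simp only: p_def h_def G_eq p_y prod.case fst_conv snd_conv flip: defs)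
  qed
  have "inj_on (h \<circ> p) (GF2 m \<times> GF2 m)"
  proof (rule inj_onI)
    fix v w assume v: "v \<in> GF2 m \<times> GF2 m" and w: "w \<in> GF2 m \<times> GF2 m" and eq: "(h \<circ> p) v = (h \<circ> p) w"
    have "G_a11a (2 ^ i) a (p v) = G_a11a (2 ^ i) a (p w)"
      using on_line [of "fst v" "snd v"] on_line [of "fst w" "snd w"] eq by simp
    moreover have "p v \<in> GF2 m \<times> GF2 m \<times> GF2 m" "p w \<in> GF2 m \<times> GF2 m \<times> GF2 m"
      using v w r t by (auto simp: p_def intro!: GF2_closed)
    ultimately have "p v = p w" by (rule inj_onD [OF inj])
    then show "v = w" by (auto simp: p_def split: prod.splits)
  qed
  moreover have "(h \<circ> p) ` (GF2 m \<times> GF2 m) \<subseteq> GF2 m"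
    using r t a by (auto simp: p_def h_def G_eq intro!: GF2_closed)
  ultimately have "card (GF2 m \<times> GF2 m) \<le> card (GF2 m)"
    using card_GF2(2) [OF m] by (rule card_inj_on_le)
  moreover have "(2::nat) \<le> 2 ^ m" using m by (cases m) auto
  ultimately show False using card_GF2 [OF m] by (auto simp: card_cartesian_product)
qed

text \<open>
  The invariant planes of \<open>t\<close> and of its conjugate \<open>t'\<close> have normal vectors \<open>(1, r, t)\<close> and
  \<open>(1, r', t')\<close>.  They meet in the line spanned by the cross product of these vectors.  Conjugation over
  \<open>K\<close> swaps the two factors; in characteristic 2 this leaves the product unchanged, so the product
  has entries in \<open>K\<close>.
\<close>

lemma conjugate_roots_imp_not_inj:
  assumes a: "a \<in> GF2 m"
    and t: "t \<in> GF2 (2 * m)" "t \<notin> GF2 m" "poly (P_poly (2 ^ i) a) t = 0"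
  shows "\<not> inj_on (G_a11a (2 ^ i) a) (GF2 m \<times> GF2 m \<times> GF2 m)"
proof
  assume inj: "inj_on (G_a11a (2 ^ i) a) (GF2 m \<times> GF2 m \<times> GF2 m)"
  define t' where "t' = frob m t"
  define r where "r = inverse (frob i t)"
  define r' where "r' = inverse (frob i t')"
  have a_fix: "frob m a = a" using a by (simp add: GF2_iff_frob)
  have t't: "frob m t' = t" using t(1) by (simp add: t'_def GF2_iff_frob frob_frob mult_2)
  have r'_eq: "r' = frob m r"
    by (simp add: r_def r'_def t'_def frob_inverse frob_commute [of i])
  have rr: "frob m r' = r"
    by (simp add: r'_def r_def frob_inverse frob_commute [of m i] t't)
  have "poly (P_poly (2 ^ i) a) t' = frob m (poly (P_poly (2 ^ i) a) t)"
    by (simp add: poly_P t'_def frob_add frob_mult frob_commute [of m i] a_fix)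
  then have t'_root: "poly (P_poly (2 ^ i) a) t' = 0" using t by simp
  have nz: "r \<noteq> 0" "r' \<noteq> 0"
    using root_imp_nonzero [OF t(3)] root_imp_nonzero [OF t'_root] by (auto simp: r_def r'_def)
  have f: "frob i t = inverse r" "frob i t' = inverse r'"
    "frob i r = (t + a) / r" "frob i r' = (t' + a) / r'"
    using root_frob [OF t(3)] root_frob [OF t'_root] by (auto simp: r_def r'_def field_simps)
  define x y z where "x = r * t' + r' * t" and "y = t + t'" and "z = r + r'"
  note v = this
  have "(x, y, z) \<in> GF2 m \<times> GF2 m \<times> GF2 m"
    by (simp add: v GF2_iff_frob frob_add frob_mult t't rr add.commute
        flip: t'_def r'_eq)
  moreover have "(0, 0, 0) \<in> GF2 m \<times> GF2 m \<times> GF2 m" by simp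
  moreover have "G_a11a (2 ^ i) a (x, y, z) = G_a11a (2 ^ i) a (0, 0, 0)"
  proof -
    have fx: "frob i x = y / (r * r')" and fy: "frob i y = z / (r * r')"
      and fz: "frob i z = (x + a * z) / (r * r')"
      using nz by (simp_all add: v frob_add frob_mult f field_simps)
    show ?thesis unfolding G_eq fx fy fz by (simp add: mult_ac)
  qed
  ultimately have "(x, y, z) = (0, 0, 0)" using inj_onD [OF inj] by blast
  then have "t \<in> GF2 m" by (simp add: v add_eq_0_iff_eq GF2_iff_frob t'_def)
  then show False using t by simp
qed

theorem theorem4p2:
  fixes i :: nat
  assumes "i \<ge> 1"
  shows "\<exists>M::nat. \<forall>m\<ge>M. odd m \<and> gcd i m = 1 \<longrightarrow>
    (let q = 2 ^ i in
      \<forall>a \<in> GF2 m.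
        bij_betw (G_a11a q a) (GF2 m \<times> GF2 m \<times> GF2 m) (GF2 m \<times> GF2 m \<times> GF2 m) \<longleftrightarrow>
        \<not> (\<exists>t \<in> GF2 (2 * m). poly (P_poly q a) t = 0))"
proof (intro exI [of _ 0] allI impI, unfold Let_def, intro ballI)
  fix m :: nat and a assume "odd m \<and> gcd i m = 1" and a: "a \<in> GF2 m"
  then have cop: "coprime i m" and odd: "odd m" and m: "m > 0"
    by (auto simp: coprime_iff_gcd_eq_1 intro: odd_pos)
  let ?K3 = "GF2 m \<times> GF2 m \<times> GF2 m" and ?G = "G_a11a (2 ^ i) a"
  have sub: "GF2 m \<subseteq> GF2 (2 * m)" by (intro GF2_mono_dvd) simp
  have "bij_betw ?G ?K3 ?K3 \<longleftrightarrow> inj_on ?G ?K3"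
    using endo_inj_surj [OF _ G_in_GF2 [OF a]] card_GF2(2) [OF m]
    by (auto simp: bij_betw_def)
  also have "\<dots> \<longleftrightarrow> \<not> (\<exists>t \<in> GF2 (2 * m). poly (P_poly (2 ^ i) a) t = 0)"
    using no_root_imp_inj [OF cop _ odd a] root_imp_not_inj [OF m a]
      conjugate_roots_imp_not_inj [OF a] assms sub by (metis less_eq_Suc_le One_nat_def subsetD)
  finally show "bij_betw ?G ?K3 ?K3 \<longleftrightarrow> \<not> (\<exists>t \<in> GF2 (2 * m). poly (P_poly (2 ^ i) a) t = 0)" .
qed

end
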